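(* Let $R$ be an $n\times n$ expanding integer matrix and let $\mathcal{D}\subset\mathbb{Z}^n$ be a set with $\#\mathcal{D}=|\det R|$. If $\mathcal{D}$ is a skew-product-form digit set with respect to $R$, then $T(R,\mathcal{D})$ is a self-affine tile.
   Context: An $n\times n$ integer matrix $R$ is expanding if all its eigenvalues have modulus strictly larger than $1$. For a finite set $\mathcal{D}\subset\mathbb{Z}^n$ with $\#\mathcal{D}=|\det R|$, $T(R,\mathcal{D})$ denotes the unique non-empty compact set $T\subset\mathbb{R}^n$ satisfying $T=\bigcup_{d\in\mathcal{D}}R^{-1}(T+d)$. It is called an (integral) self-affine tile if it has non-empty interior (equivalently, by known results, positive Lebesgue measure; it is then known to tile $\mathbb{R}^n$ by translations). A complete residue set modulo $R$ is a subset of $\mathbb{Z}^n$ containing exactly one element of each coset of $R\mathbb{Z}^n$ in $\mathbb{Z}^n$. $\mathcal{A}\oplus\mathcal{B}$ denotes the sumset $\mathcal{A}+\mathcal{B}$ when all sums $a+b$ ($a\in\mathcal{A}$, $b\in\mathcal{B}$) are distinct. For an integer $m\ge 1$, a set $\mathcal{D}\subset\mathbb{Z}^n$ with $\#\mathcal{D}=|\det R|$ is an $m$-stage skew-product-form digit set with respect to $R$ if there exist $\mathcal{A}=\{a_j\}_{j=0}^{s-1}\subset\mathbb{Z}^n$ (with $s$ distinct elements) and $\mathcal{B}_0,\dots,\mathcal{B}_{s-1}\subset\mathbb{Z}^n$ such that $\mathcal{D}=\bigcup_{j=0}^{s-1}(a_j+R^m\mathcal{B}_j)$ and, for each $j=0,\dots,s-1$,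 the sum $\mathcal{A}+\mathcal{B}_j$ is direct and $\mathcal{A}\oplus\mathcal{B}_j$ is a complete residue set modulo $R$. When $m=1$, $\mathcal{D}$ is called a skew-product-form digit set with respect to $R$. *)

theory Defs
  imports "HOL-Analysis.Analysis" "HOL-Library.Set_Algebras"
begin

definition of_int_vec :: "int ^ 'n \<Rightarrow> real ^ 'n" where
  "of_int_vec x = (\<chi> i. of_int (x $ i))"

definition eigenvalue :: "'a::field ^ 'n ^ 'n \<Rightarrow> 'a \<Rightarrow> bool" where
  "eigenvalue A c \<longleftrightarrow> (\<exists>v. v \<noteq> 0 \<and> A *v v = c *s v)"

definition expanding :: "int ^ 'n ^ 'n \<Rightarrow> bool" where
  "expanding R \<longleftrightarrow> (\<forall>c::complex. eigenvalue (map_matrix of_int R) c \<longrightarrow> 1 < norm c)"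

(* For expanding R and finite non-empty D, exactly one such T exists (Hutchinson);
   for other R and D the definite description may be unspecified. *)
definition self_affine_set :: "int ^ 'n ^ 'n \<Rightarrow> (int ^ 'n) set \<Rightarrow> (real ^ 'n) set" where
  "self_affine_set R D = (THE T. T \<noteq> {} \<and> compact T \<and>
     T = (\<Union>d\<in>D. (\<lambda>x. matrix_inv (map_matrix of_int R) *v (x + of_int_vec d)) ` T))"

definition self_affine_tile :: "int ^ 'n ^ 'n \<Rightarrow> (int ^ 'n) set \<Rightarrow> bool" where
  "self_affine_tile R D \<longleftrightarrow> interior (self_affine_set R D) \<noteq> {}"

definition complete_residue_set :: "int ^ 'n ^ 'n \<Rightarrow> (int ^ 'n) set \<Rightarrow> bool" where
  "complete_residue_set R C \<longleftrightarrow> (\<forall>x. \<exists>!c. c \<in> C \<and> c \<in> x +o range ((*v) R))"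

definition direct_sumset :: "'a::plus set \<Rightarrow> 'a set \<Rightarrow> bool" where
  "direct_sumset A B \<longleftrightarrow> inj_on (\<lambda>(a, b). a + b) (A \<times> B)"

(* R^m acts on vectors as the m-fold iterate of multiplication by R; the power
   notation on the type of matrices would be the componentwise power. *)
definition skew_product_form_stage ::
    "nat \<Rightarrow> int ^ 'n ^ 'n \<Rightarrow> (int ^ 'n) set \<Rightarrow> bool" where
  "skew_product_form_stage m R D \<longleftrightarrow>
     1 \<le> m \<and> finite D \<and> int (card D) = \<bar>det R\<bar> \<and>
     (\<exists>(s::nat) a B. inj_on a {..<s} \<and>
        D = (\<Union>j<s. a j +o (((*v) R) ^^ m) ` B j) \<and>
        (\<forall>j<s. direct_sumset (a ` {..<s}) (B j) \<and>
               complete_residue_set R (a ` {..<s} + B j)))"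

definition skew_product_form :: "int ^ 'n ^ 'n \<Rightarrow> (int ^ 'n) set \<Rightarrow> bool" where
  "skew_product_form R D \<longleftrightarrow> skew_product_form_stage 1 R D"

end

theory Submission
  imports Defs "HOL-Computational_Algebra.Fundamental_Theorem_Algebra"
begin

text \<open>
  Let \<open>A\<close> be the set of the elements \<open>a j\<close> and put \<open>Z = A + R \<int>\<^sup>n\<close>.  Since \<open>A + B j\<close> meets every
  residue class modulo \<open>R\<close>, we have \<open>B j + A + R \<int>\<^sup>n = \<int>\<^sup>n\<close> and therefore
  \<open>D + R Z = \<Union>\<^sub>j (a j + R (B j + A + R \<int>\<^sup>n)) = Z\<close>: the periodic set \<open>Z\<close> reproduces itself under the
  digits \<open>D\<close>, although \<open>D\<close> itself need not be a residue system.

  Write \<open>T\<close> for the attractor, so that \<open>R T = T + D\<close>, and let \<open>X = T + Z\<close>.  Then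
  \<open>R X = T + D + R Z = X\<close>, hence \<open>X\<close> is invariant under \<open>R\<^sup>-\<^sup>1\<close>.  Because \<open>Z\<close> contains a translate of
  \<open>R \<int>\<^sup>n\<close>, every point of space is within a fixed distance \<open>M\<close> of \<open>X\<close>; contracting by \<open>R\<^sup>-\<^sup>k\<close> makes this
  distance arbitrarily small, so \<open>X\<close> is dense.  Being the sum of a compact and a closed set it is
  closed, so \<open>X\<close> is the whole space (\<open>translates_of_attractor_cover\<close>).  Space is thus a countable
  union of translates of the closed set \<open>T\<close>, and by Baire's theorem \<open>T\<close> has interior points
  (\<open>interior_nonempty_of_countable_cover\<close>).

  Two general facts support this.  The eigenvalue condition is turned into contraction: a complex
  matrix with all eigenvalues in the open unit disc has iterates tending to \<open>0\<close>
  (\<open>complex_matrix_iterates_tendsto_0\<close>), and a linear map with this property is a strict contraction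
  for a suitable norm (\<open>exists_adapted_norm\<close>).  Contraction in turn yields existence and uniqueness of
  the attractor (\<open>attractor_exists\<close>, \<open>attractor_subset\<close>), so that the definite description in
  \<open>self_affine_set\<close> denotes it.
\<close>

section \<open>Iterates of a matrix whose eigenvalues lie in the open unit disc\<close>

definition poly_act :: "complex ^ 'n ^ 'n \<Rightarrow> complex poly \<Rightarrow> complex ^ 'n \<Rightarrow> complex ^ 'n" where
  "poly_act M p v = (\<Sum>i\<le>degree p. coeff p i *s ((*v) M ^^ i) v)"

lemma poly_act_bound:
  "degree p \<le> n \<Longrightarrow> poly_act M p v = (\<Sum>i\<le>n. coeff p i *s ((*v) M ^^ i) v)"
  unfolding poly_act_def
  by (rule sum.mono_neutral_left) (auto simp: coeff_eq_0)

lemma poly_act_add: "poly_act M (p + q) v = poly_act M p v + poly_act M q v"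
proof -
  let ?n = "max (degree p) (degree q)"
  have "degree (p + q) \<le> ?n" by (rule degree_add_le_max)
  then show ?thesis
    by (simp add: poly_act_bound[of _ ?n] sum.distrib vec.scale_left_distrib)
qed

lemma poly_act_smult: "poly_act M (smult c p) v = c *s poly_act M p v"
  by (simp add: poly_act_bound[of "smult c p" "degree p"] poly_act_def vec.scale_sum_right
      degree_smult_le)

lemma poly_act_shift: "poly_act M (pCons 0 p) v = poly_act M p (M *v v)"
proof -
  have "poly_act M (pCons 0 p) v = (\<Sum>i\<le>Suc (degree p). coeff (pCons 0 p) i *s ((*v) M ^^ i) v)"
    by (rule poly_act_bound) (rule degree_pCons_le)
  also have "\<dots> = poly_act M p (M *v v)"
    by (simp only: sum.atMost_Suc_shift) (simp add: poly_act_def funpow_swap1)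
  finally show ?thesis .
qed

lemma funpow_linear_diff:
  fixes M :: "'a::field ^ 'n ^ 'n"
  shows "((*v) M ^^ k) (v - c *s w) = ((*v) M ^^ k) v - c *s ((*v) M ^^ k) w"
  by (induction k) (auto simp: matrix_vector_mult_diff_distrib vec.linear_scale[OF matrix_vector_mul_linear_gen])

lemma poly_act_diff:
  "poly_act M p (v - c *s w) = poly_act M p v - c *s poly_act M p w"
  by (simp add: poly_act_def funpow_linear_diff vec.scale_right_diff_distrib sum_subtractf
      vec.scale_sum_right mult.commute)

lemma poly_act_commute: "poly_act M p (M *v v) = M *v poly_act M p v"
  by (simp add: poly_act_def vec.linear_sum[OF matrix_vector_mul_linear_gen] 
      vec.linear_scale[OF matrix_vector_mul_linear_gen] funpow_swap1)

lemma poly_act_linear_factor: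
  "poly_act M ([:- c, 1:] * q) v = poly_act M q (M *v v - c *s v)"
  by (simp add: poly_act_add poly_act_smult poly_act_shift poly_act_diff del: smult_minus_left)

text \<open>
  The vectors \<open>v, M v, \<dots>, M\<^sup>n v\<close> are too many to be linearly independent; a dependency between them
  is a polynomial.  A repetition among them has to be treated apart, as linear dependence concerns
  sets and does not see it.
\<close>

lemma exists_annihilating_poly:
  fixes M :: "complex ^ 'n ^ 'n"
  shows "\<exists>p. p \<noteq> 0 \<and> poly_act M p v = 0"
proof -
  define u where "u i = ((*v) M ^^ i) v" for i
  let ?n = "CARD('n)"
  show ?thesis
  proof (cases "inj_on u {..?n}")
    case True
    then have "card (u ` {..?n}) = Suc ?n" by (simp add: card_image)
    moreover have "vec.dim (u ` {..?n}) \<le> ?n"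
      using vec.dim_subset_UNIV[of "u ` {..?n}"] by (simp add: vec.dimension_def card_cart_basis)
    ultimately have "vec.dependent (u ` {..?n})"
      by (intro vec.dependent_biggerset_general) auto
    then obtain c where c: "\<exists>w\<in>u ` {..?n}. c w \<noteq> 0" "(\<Sum>w\<in>u ` {..?n}. c w *s w) = 0"
      by (auto simp: vec.dependent_finite)
    define p where "p = (\<Sum>i\<le>?n. monom (c (u i)) i)"
    have cf: "coeff p i = (if i \<le> ?n then c (u i) else 0)" for i
      by (simp add: p_def coeff_sum)
    have "degree p \<le> ?n" by (rule degree_le) (simp add: cf)
    then have "poly_act M p v = (\<Sum>i\<le>?n. c (u i) *s u i)"
      by (simp add: poly_act_bound cf u_def)
    also have "\<dots> = 0" using c(2) True by (simp add: sum.reindex)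
    finally have "poly_act M p v = 0" .
    moreover have "p \<noteq> 0" using c(1) cf by (metis atMost_iff coeff_0 imageE)
    ultimately show ?thesis by blast
  next
    case False
    then obtain i j where ij: "u i = u j" "i \<noteq> j" by (auto simp: inj_on_def)
    define p :: "complex poly" where "p = monom 1 i + smult (-1) (monom 1 j)"
    have act: "poly_act M (monom 1 k) v = u k" for k
    proof -
      have "poly_act M (monom 1 k) v = (\<Sum>i\<le>k. if k = i then u i else 0)"
        unfolding poly_act_def degree_monom_eq[OF one_neq_zero]
        by (rule sum.cong) (auto simp: u_def)
      then show ?thesis by simp
    qed
    have "poly_act M p v = 0"
      by (simp only: p_def poly_act_add poly_act_smult act) (simp add: ij)
    moreover have "coeff p i = 1" using ij by (simp add: p_def)
    then have "p \<noteq> 0" by auto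
    ultimately show ?thesis by blast
  qed
qed

lemma geometric_eventually_less:
  fixes c :: real
  assumes c: "0 \<le> c" "c < 1" and e: "0 < e"
  shows "\<exists>L. \<forall>k\<ge>L. c ^ k * B < e"
proof -
  have "(\<lambda>k. c ^ k * B) \<longlonglongrightarrow> 0 * B"
    using c by (intro tendsto_mult LIMSEQ_power_zero tendsto_const) auto
  with e have "\<forall>\<^sub>F k in sequentially. c ^ k * B < e"
    by (intro order_tendstoD(2)) auto
  then show ?thesis by (simp add: eventually_sequentially)
qed

lemma contractive_recurrence_tendsto_0:
  fixes u w :: "nat \<Rightarrow> 'a::real_normed_vector"
  assumes step: "\<And>k. norm (u (Suc k)) \<le> c * norm (u k) + norm (w k)"
    and c: "0 \<le> c" "c < 1" and w: "w \<longlonglongrightarrow> 0"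
  shows "u \<longlonglongrightarrow> 0"
proof (rule LIMSEQ_I)
  fix e :: real assume e: "0 < e"
  define d where "d = (1 - c) * (e / 2)"
  have d: "0 < d" using e c by (simp add: d_def)
  obtain K where K: "\<And>k. k \<ge> K \<Longrightarrow> norm (w k) < d"
    using LIMSEQ_D[OF w d] by auto
  \<comment> \<open>The level \<open>e / 2\<close> is the fixed point of \<open>x \<mapsto> c * x + d\<close>; the excess over it decays geometrically.\<close>
  have excess: "norm (u (K + k)) \<le> e / 2 + c ^ k * norm (u K)" for k
  proof (induction k)
    case 0 then show ?case using e by simp
  next
    case (Suc k)
    have "norm (u (K + Suc k)) \<le> c * norm (u (K + k)) + d"
      using step[of "K + k"] K[of "K + k"] by simp
    also have "\<dots> \<le> c * (e / 2 + c ^ k * norm (u K)) + d"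
      using Suc c by (simp add: mult_left_mono)
    also have "\<dots> = e / 2 + c ^ Suc k * norm (u K)"
      by (simp add: d_def field_simps)
    finally show ?case .
  qed
  obtain L where L: "\<And>k. k \<ge> L \<Longrightarrow> c ^ k * norm (u K) < e / 2"
    using geometric_eventually_less[OF c, of "e / 2"] e by auto
  have "norm (u k - 0) < e" if "k \<ge> K + L" for k
  proof -
    have "K + (k - K) = k" "L \<le> k - K" using that by auto
    then show ?thesis using excess[of "k - K"] L[of "k - K"] by simp
  qed
  then show "\<exists>no. \<forall>n\<ge>no. norm (u n - 0) < e" by blast
qed

lemma norm_scale_vec: "norm (c *s (v :: complex ^ 'n)) = norm c * norm v"
  by (simp add: norm_vec_def norm_mult L2_set_right_distrib)

text \<open>
  Induction on the degree, splitting off a root \<open>c\<close> of \<open>p\<close>.  The vector \<open>w = M v - c v\<close> is killed by the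
  cofactor, so its iterates tend to \<open>0\<close>.  If \<open>c\<close> is an eigenvalue then \<open>\<bar>c\<bar> < 1\<close>, and the iterates of \<open>v\<close>
  follow the recurrence \<open>u\<^bsub>k+1\<^esub> = c u\<^sub>k + M\<^sup>k w\<close>, a contraction with a perturbation that dies out.
  Otherwise \<open>M - c\<close> is injective and the factor belonging to \<open>c\<close> can be dropped.
\<close>

lemma annihilated_tendsto_0:
  fixes M :: "complex ^ 'n ^ 'n"
  assumes ev: "\<And>c. eigenvalue M c \<Longrightarrow> norm c < 1"
  shows "p \<noteq> 0 \<Longrightarrow> poly_act M p v = 0 \<Longrightarrow> (\<lambda>k. ((*v) M ^^ k) v) \<longlonglongrightarrow> 0"
proof (induction "degree p" arbitrary: p v)
  case 0
  then obtain a where "p = [:a:]" by (metis degree_0_id)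
  with 0 have "v = 0" by (simp add: poly_act_def)
  moreover have "((*v) M ^^ k) 0 = 0" for k by (induction k) auto
  ultimately show ?case by simp
next
  case (Suc n)
  obtain c where "poly p c = 0"
    using fundamental_theorem_of_algebra[of p] Suc(2) constant_degree[of p] by force
  then obtain q where q: "p = [:- c, 1:] * q" by (metis dvdE poly_eq_0_iff_dvd)
  have q0: "q \<noteq> 0" using q Suc.prems by auto
  have "degree p = Suc (degree q)" unfolding q using q0 by (subst degree_mult_eq) auto
  then have dq: "n = degree q" using Suc by simp
  define w where "w = M *v v - c *s v"
  have qw: "poly_act M q w = 0"
    using Suc.prems(2) by (simp only: q poly_act_linear_factor w_def)
  show ?case
  proof (cases "eigenvalue M c")
    case True
    have w0: "(\<lambda>k. ((*v) M ^^ k) w) \<longlonglongrightarrow> 0" by (rule Suc(1)[OF dq q0 qw])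
    have "norm (((*v) M ^^ Suc k) v) \<le> norm c * norm (((*v) M ^^ k) v) + norm (((*v) M ^^ k) w)" for k
    proof -
      have "((*v) M ^^ Suc k) v = c *s ((*v) M ^^ k) v + ((*v) M ^^ k) w"
        by (simp add: w_def funpow_linear_diff funpow_swap1)
      then show ?thesis by (metis norm_triangle_ineq norm_scale_vec)
    qed
    then show ?thesis
      by (rule contractive_recurrence_tendsto_0[OF _ norm_ge_zero ev[OF True] w0])
  next
    case False
    have "M *v poly_act M q v = c *s poly_act M q v"
      using qw by (simp add: w_def poly_act_diff poly_act_commute)
    then have "poly_act M q v = 0" using False by (auto simp: eigenvalue_def)
    then show ?thesis by (rule Suc(1)[OF dq q0])
  qed
qed

lemma complex_matrix_iterates_tendsto_0:
  fixes M :: "complex ^ 'n ^ 'n"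
  assumes "\<And>c. eigenvalue M c \<Longrightarrow> norm c < 1"
  shows "(\<lambda>k. ((*v) M ^^ k) v) \<longlonglongrightarrow> 0"
  using exists_annihilating_poly[of M v] annihilated_tendsto_0[OF assms] by blast

text \<open>
  Carries integer vectors to real ones and real vectors to complex ones, the two changes of scalars
  that relate the eigenvalues of an integer matrix to its action on real space.
\<close>

lemma map_matrix_mult_vec:
  assumes h0: "h 0 = 0" and hadd: "\<And>x y. h (x + y) = h x + h y"
    and hmult: "\<And>x y. h (x * y) = h x * h y"
  shows "map_matrix h A *v (\<chi> i. h (v $ i)) = (\<chi> i. h ((A *v v) $ i))"
proof -
  have s: "h (sum f S) = (\<Sum>x\<in>S. h (f x))" for f and S :: "'x set"
    by (induction S rule: infinite_finite_induct) (auto simp: h0 hadd)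
  show ?thesis by (simp add: matrix_vector_mult_def s hmult vec_eq_iff)
qed

text \<open>A real vector in the kernel would be a complex eigenvector for the eigenvalue \<open>0\<close>.\<close>

lemma expanding_imp_invertible:
  fixes R :: "int ^ 'n ^ 'n"
  assumes "expanding R"
  shows "invertible (map_matrix real_of_int R)"
proof -
  let ?A = "map_matrix real_of_int R"
  have "v = 0" if v: "?A *v v = 0" for v
  proof (rule ccontr)
    let ?v = "\<chi> i. complex_of_real (v $ i)"
    assume "v \<noteq> 0"
    then have "?v \<noteq> 0" by (auto simp: vec_eq_iff)
    moreover have "map_matrix complex_of_real ?A *v ?v = 0"
      by (subst map_matrix_mult_vec) (auto simp: v vec_eq_iff)
    moreover have "map_matrix complex_of_real ?A = map_matrix of_int R"
      by (simp add: vec_eq_iff)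
    ultimately have "eigenvalue (map_matrix of_int R) (0::complex)"
      unfolding eigenvalue_def by (intro exI[of _ ?v]) auto
    then show False using assms by (force simp: expanding_def)
  qed
  then show ?thesis
    by (simp add: invertible_left_inverse matrix_left_invertible_ker)
qed

text \<open>
  The eigenvalues of the inverse are the reciprocals of those of \<open>R\<close>; the decay of its complex iterates
  is read off on real vectors.
\<close>

lemma expanding_inverse_iterates_tendsto_0:
  fixes R :: "int ^ 'n ^ 'n"
  assumes R: "expanding R" and inv: "map_matrix real_of_int R ** P = mat 1"
  shows "(\<lambda>k. ((*v) P ^^ k) v) \<longlonglongrightarrow> 0"
proof -
  let ?M = "map_matrix complex_of_real P"
  let ?R = "map_matrix of_int R :: complex ^ 'n ^ 'n"
  let ?c = "\<lambda>v. (\<chi> i. complex_of_real (v $ i)) :: complex ^ 'n"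
  have inv_c: "?R ** ?M = mat 1"
  proof -
    have "(\<Sum>k\<in>UNIV. of_int (R $ i $ k) * complex_of_real (P $ k $ j)) 
        = complex_of_real ((map_matrix real_of_int R ** P) $ i $ j)" for i j
      by (simp add: matrix_matrix_mult_def)
    then show ?thesis unfolding inv by (simp add: vec_eq_iff matrix_matrix_mult_def mat_def)
  qed
  have ev: "norm c < 1" if c: "eigenvalue ?M c" for c
  proof -
    obtain x where x: "x \<noteq> 0" "?M *v x = c *s x" using c by (auto simp: eigenvalue_def)
    have "x = ?R *v (?M *v x)" by (simp add: matrix_vector_mul_assoc inv_c)
    then have xc: "x = c *s (?R *v x)"
      by (simp add: x vec.linear_scale[OF matrix_vector_mul_linear_gen])
    with x have c0: "c \<noteq> 0" by auto
    have "?R *v x = inverse c *s x" by (subst (2) xc) (simp add: c0)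
    then have "eigenvalue ?R (inverse c)" using x by (auto simp: eigenvalue_def)
    then have "1 < norm (inverse c)" using R by (auto simp: expanding_def)
    then show ?thesis by (simp add: norm_inverse one_less_inverse_iff)
  qed
  have it: "((*v) ?M ^^ k) (?c v) = ?c (((*v) P ^^ k) v)" for k
    by (induction k) (auto simp: map_matrix_mult_vec)
  have norm_c: "norm (?c w) = norm w" for w :: "real ^ 'n" by (simp add: norm_vec_def)
  have "(\<lambda>k. ?c (((*v) P ^^ k) v)) \<longlonglongrightarrow> 0"
    unfolding it[symmetric] by (rule complex_matrix_iterates_tendsto_0[OF ev])
  from tendsto_norm_zero[OF this] show ?thesis
    unfolding norm_c by (rule tendsto_norm_zero_cancel)
qed

section \<open>An adapted norm\<close>

lemma linear_funpow: "linear f \<Longrightarrow> linear (f ^^ k)" for f :: "'a::real_vector \<Rightarrow> 'a"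
  by (induction k) (auto intro: linear_compose linear_id simp: id_def[symmetric])

text \<open>
  In finite dimension pointwise convergence of linear maps is uniform on bounded sets: it suffices
  to look at a basis.
\<close>

lemma iterate_norm_halved:
  fixes f :: "'a::euclidean_space \<Rightarrow> 'a"
  assumes f: "linear f" and lim: "\<And>v. (\<lambda>k. (f ^^ k) v) \<longlonglongrightarrow> 0"
  shows "\<exists>N\<ge>1. \<forall>x. norm ((f ^^ N) x) \<le> norm x / 2"
proof -
  have "(\<lambda>k. \<Sum>b\<in>Basis. norm ((f ^^ k) b)) \<longlonglongrightarrow> (\<Sum>b\<in>(Basis::'a set). 0)"
    by (intro tendsto_sum tendsto_norm_zero lim)
  then have "\<forall>\<^sub>F k in sequentially. (\<Sum>b\<in>Basis. norm ((f ^^ k) b)) < 1 / 2"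
    by (intro order_tendstoD(2)) auto
  then obtain N0 where N0: "\<And>k. k \<ge> N0 \<Longrightarrow> (\<Sum>b\<in>Basis. norm ((f ^^ k) b)) < 1 / 2"
    by (auto simp: eventually_sequentially)
  define N where "N = Suc N0"
  have S: "(\<Sum>b\<in>Basis. norm ((f ^^ N) b)) \<le> 1 / 2" using N0[of N] by (simp add: N_def del: funpow.simps)
  have "norm ((f ^^ N) x) \<le> norm x / 2" for x
  proof -
    interpret l: linear "f ^^ N" by (rule linear_funpow[OF f])
    have "(f ^^ N) x = (f ^^ N) (\<Sum>b\<in>Basis. (x \<bullet> b) *\<^sub>R b)" by (simp add: euclidean_representation)
    also have "\<dots> = (\<Sum>b\<in>Basis. (x \<bullet> b) *\<^sub>R (f ^^ N) b)" by (simp add: l.sum l.scale)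
    finally have "norm ((f ^^ N) x) \<le> (\<Sum>b\<in>Basis. norm ((x \<bullet> b) *\<^sub>R (f ^^ N) b))"
      by (simp only: norm_sum)
    also have "\<dots> = (\<Sum>b\<in>Basis. \<bar>x \<bullet> b\<bar> * norm ((f ^^ N) b))" by simp
    also have "\<dots> \<le> (\<Sum>b\<in>Basis. norm x * norm ((f ^^ N) b))"
      by (intro sum_mono mult_right_mono Basis_le_norm) auto
    also have "\<dots> \<le> norm x * (1 / 2)"
      unfolding sum_distrib_left[symmetric] using S by (intro mult_left_mono) auto
    finally show ?thesis by simp
  qed
  then show ?thesis by (intro exI[of _ N]) (auto simp: N_def)
qed

text \<open>
  The properties of a norm equivalent to the given one, for which \<open>f\<close> is a strict contraction, as far
  as the arguments below call for them.
\<close>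

definition adapted_norm :: "('a::real_normed_vector \<Rightarrow> 'a) \<Rightarrow> real \<Rightarrow> real \<Rightarrow> ('a \<Rightarrow> real) \<Rightarrow> bool" where
  "adapted_norm f c C q \<longleftrightarrow> 0 \<le> c \<and> c < 1 \<and> 0 \<le> C \<and> continuous_on UNIV q \<and>
     (\<forall>x y. q (x + y) \<le> q x + q y) \<and> (\<forall>x. norm x \<le> q x \<and> q x \<le> C * norm x \<and> q (f x) \<le> c * q x)"

text \<open>
  If \<open>f\<^sup>N\<close> halves norms then \<open>q x = \<Sum>k<N. norm (f\<^sup>k x)\<close> works: passing from \<open>x\<close> to \<open>f x\<close> replaces the
  summand \<open>norm x\<close> by \<open>norm (f\<^sup>N x) \<le> norm x / 2\<close>, a loss of at least \<open>norm x / 2 \<ge> q x / (2 * C)\<close>.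
\<close>

lemma exists_adapted_norm:
  fixes f :: "'a::euclidean_space \<Rightarrow> 'a"
  assumes f: "linear f" and lim: "\<And>v. (\<lambda>k. (f ^^ k) v) \<longlonglongrightarrow> 0"
  shows "\<exists>c C q. adapted_norm f c C q"
proof -
  obtain N where N: "N \<ge> 1" "\<And>x. norm ((f ^^ N) x) \<le> norm x / 2"
    using iterate_norm_halved[OF assms] by blast
  note lin = linear_funpow[OF f]
  define q where "q x = (\<Sum>k<N. norm ((f ^^ k) x))" for x
  have "\<exists>B. \<forall>x. norm ((f ^^ k) x) \<le> B * norm x" for k
    using linear_bounded[OF lin] by blast
  then obtain B where B: "\<And>k x. norm ((f ^^ k) x) \<le> B k * norm x" by metis
  define C where "C = max 1 (\<Sum>k<N. B k)"
  have C: "1 \<le> C" by (simp add: C_def)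
  have qC: "q x \<le> C * norm x" for x
  proof -
    have "q x \<le> (\<Sum>k<N. B k) * norm x"
      unfolding q_def sum_distrib_right by (intro sum_mono B)
    also have "\<dots> \<le> C * norm x" by (intro mult_right_mono) (auto simp: C_def)
    finally show ?thesis .
  qed
  have qn: "norm x \<le> q x" for x
    using member_le_sum[of 0 "{..<N}" "\<lambda>k. norm ((f ^^ k) x)"] N(1) by (simp add: q_def)
  have qf: "q (f x) \<le> (1 - 1 / (2 * C)) * q x" for x
  proof -
    have "q (f x) + norm x = q x + norm ((f ^^ N) x)"
    proof -
      have "q (f x) + norm x = (\<Sum>k<Suc N. norm ((f ^^ k) x))"
        unfolding q_def by (subst sum.lessThan_Suc_shift) (simp add: funpow_swap1)
      then show ?thesis by (simp add: q_def)
    qed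
    with N(2)[of x] have "q (f x) \<le> q x - norm x / 2" by linarith
    moreover have "q x / (2 * C) \<le> norm x / 2"
      using qC[of x] C by (simp add: field_simps)
    ultimately show ?thesis by (simp add: algebra_simps)
  qed
  have "q (x + y) \<le> q x + q y" for x y
    unfolding q_def sum.distrib[symmetric] linear_add[OF lin]
    by (intro sum_mono norm_triangle_ineq)
  moreover have "continuous_on UNIV q"
    unfolding q_def by (intro continuous_intros linear_continuous_on linear_linear[THEN iffD2] lin)
  moreover have "0 \<le> 1 - 1 / (2 * C)" "1 - 1 / (2 * C) < 1" using C by (auto simp: field_simps)
  ultimately have "adapted_norm f (1 - 1 / (2 * C)) C q"
    unfolding adapted_norm_def using qC qn qf C by auto
  then show ?thesis by blast
qed

section \<open>Existence and uniqueness of the attractor\<close>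

definition hutchinson :: "('a \<Rightarrow> 'a) \<Rightarrow> 'a set \<Rightarrow> 'a set \<Rightarrow> 'a::plus set" where
  "hutchinson f D S = (\<Union>d\<in>D. (\<lambda>x. f (x + d)) ` S)"

text \<open>
  A sufficiently large ball \<open>K\<close> of the adapted norm is mapped into itself by the Hutchinson operator, so
  its iterates form a nested sequence of compact sets, whose intersection is a fixed point.
\<close>

lemma attractor_exists:
  fixes f :: "'a::euclidean_space \<Rightarrow> 'a"
  assumes f: "linear f" and q: "adapted_norm f c C q" and D: "finite D" "D \<noteq> {}"
  shows "\<exists>T. T \<noteq> {} \<and> compact T \<and> T = hutchinson f D T"
proof -
  let ?F = "hutchinson f D"
  note q' = q[unfolded adapted_norm_def]
  define m where "m = (\<Sum>d\<in>D. q d)"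
  have q0: "0 \<le> q x" for x using q' norm_ge_zero order_trans by blast
  have m: "q d \<le> m" if "d \<in> D" for d
    unfolding m_def using that D q0 by (intro member_le_sum) auto
  have m0: "0 \<le> m" unfolding m_def by (intro sum_nonneg q0)
  \<comment> \<open>A digit pushes the ball of radius \<open>r\<close> into that of radius \<open>r + m\<close>; for this \<open>r\<close> the contraction undoes it.\<close>
  define r where "r = c * m / (1 - c)"
  define K where "K = {x. q x \<le> r}"
  have rm: "c * (r + m) = r" using q' by (simp add: r_def field_simps)
  have r0: "0 \<le> r" using q' m0 by (simp add: r_def)
  have FK: "?F K \<subseteq> K"
  proof -
    have "q (f (x + d)) \<le> r" if "q x \<le> r" "d \<in> D" for x d
    proof -
      have "q (x + d) \<le> r + m" using q' m[OF that(2)] that(1) by (smt (verit))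
      then have "c * q (x + d) \<le> c * (r + m)" using q' by (intro mult_left_mono) auto
      then show ?thesis using q' rm by (metis order_trans)
    qed
    then show ?thesis by (auto simp: K_def hutchinson_def)
  qed
  have F_mono: "?F S \<subseteq> ?F S'" if "S \<subseteq> S'" for S S' using that by (auto simp: hutchinson_def)
  have F_compact: "compact (?F S)" if "compact S" for S
    unfolding hutchinson_def
    by (intro compact_UN compact_continuous_image that D linear_continuous_on_compose[OF _ f]
        continuous_intros)
  define S where "S k = (?F ^^ k) K" for k
  have S0: "S 0 = K" and SSuc: "S (Suc k) = ?F (S k)" for k by (auto simp: S_def)
  have "compact K"
  proof -
    have "closed K" unfolding K_def using q' by (intro closed_Collect_le continuous_on_const) auto
    moreover have "bounded K" unfolding bounded_iff K_def using q' by (blast intro: order_trans)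
    ultimately show ?thesis by (simp add: compact_eq_bounded_closed)
  qed
  have "q 0 \<le> C * norm (0::'a)" using q' by blast
  then have "0 \<in> K" using r0 by (simp add: K_def)
  have cS: "compact (S k)" for k
    by (induction k) (auto simp: S0 SSuc \<open>compact K\<close> F_compact)
  have neS: "S k \<noteq> {}" for k
    using \<open>0 \<in> K\<close> D by (induction k) (auto simp: S0 SSuc hutchinson_def)
  have "S (Suc k) \<subseteq> S k" for k
    by (induction k) (use FK F_mono in \<open>auto simp: S0 SSuc\<close>)
  then have decS: "S n \<subseteq> S k" if "k \<le> n" for k n
    using that by (rule lift_Suc_antimono_le)
  define T where "T = (\<Inter>k. S k)"
  have "T \<noteq> {}" unfolding T_def by (rule compact_nest[OF cS neS decS])
  moreover have "compact T" unfolding T_def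
    by (intro compact_Inter) (auto simp: cS)
  moreover have "?F T \<subseteq> T"
  proof -
    have "?F T \<subseteq> S (Suc k)" for k unfolding SSuc by (rule F_mono) (auto simp: T_def)
    then show ?thesis unfolding T_def by (meson INT_greatest \<open>\<And>k. S (Suc k) \<subseteq> S k\<close> subset_trans)
  qed
  moreover have "T \<subseteq> ?F T"
  proof
    fix x assume "x \<in> T"
    then have "\<exists>d\<in>D. \<exists>y\<in>S k. x = f (y + d)" for k
    proof -
      have "x \<in> ?F (S k)" using \<open>x \<in> T\<close> unfolding T_def SSuc[symmetric] by blast
      then show ?thesis by (auto simp: hutchinson_def)
    qed
    then obtain d y where dy: "\<And>k. d k \<in> D" "\<And>k. y k \<in> S k" "\<And>k. x = f (y k + d k)" by metis
    \<comment> \<open>Finitely many digits serve infinitely many levels, so one digit recurs at arbitrarily high levels.\<close>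
    have "d ` UNIV \<subseteq> D" using dy(1) by auto
    then have "finite (range d)" using D(1) finite_subset by blast
    then obtain e where e: "e \<in> range d" "infinite {k. d k = e}"
      using pigeonhole_infinite[of "UNIV :: nat set" d] by auto
    \<comment> \<open>The preimages of \<open>x\<close> under the digit \<open>e\<close> form nested compact sets.\<close>
    define W where "W k = S k \<inter> {y. f (y + e) = x}" for k
    have "W k \<noteq> {}" for k
    proof -
      obtain l where "l > k" "d l = e" using e(2) unfolding infinite_nat_iff_unbounded by blast
      then have "y l \<in> W k" using dy(2,3)[of l] decS[of k l] by (auto simp: W_def)
      then show ?thesis by blast
    qed
    moreover have "compact (W k)" for k
      unfolding W_def
      by (intro compact_Int_closed cS closed_Collect_eq continuous_on_const
          continuous_intros linear_continuous_on_compose[OF _ f])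
    moreover have "W n \<subseteq> W k" if "k \<le> n" for k n using decS[OF that] by (auto simp: W_def)
    ultimately have "\<Inter>(range W) \<noteq> {}" by (intro compact_nest) auto
    then obtain z where "z \<in> T" "f (z + e) = x" by (auto simp: W_def T_def)
    then show "x \<in> ?F T" using e(1) dy(1) by (auto simp: hutchinson_def)
  qed
  ultimately show ?thesis by blast
qed

text \<open>
  One application of the same digit to \<open>s \<in> T\<close> and \<open>t \<in> T'\<close> brings them closer by the factor \<open>c\<close>.  Since
  every point of \<open>T\<close> has digit expansions of any length, it is a limit of points of \<open>T'\<close>.  By symmetry
  two attractors coincide.
\<close>

lemma attractor_subset:
  fixes f :: "'a::euclidean_space \<Rightarrow> 'a"
  assumes f: "linear f" and q: "adapted_norm f c C q"
    and T: "compact T" "T = hutchinson f D T" and T': "T' \<noteq> {}" "compact T'" "T' = hutchinson f D T'"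
  shows "T \<subseteq> T'"
proof
  fix x assume x: "x \<in> T"
  note q' = q[unfolded adapted_norm_def]
  have "bounded ((\<lambda>(s, t). s - t) ` (T \<times> T'))"
    by (intro compact_imp_bounded compact_continuous_image compact_Times T T')
       (auto intro!: continuous_intros simp: case_prod_unfold)
  then obtain B where B: "\<And>s t. s \<in> T \<Longrightarrow> t \<in> T' \<Longrightarrow> norm (s - t) \<le> B"
    by (force simp: bounded_iff)
  have near: "\<exists>t\<in>T'. q (s - t) \<le> c ^ k * (C * B)" if "s \<in> T" for s k
    using that
  proof (induction k arbitrary: s)
    case 0
    obtain t where t: "t \<in> T'" using T' by blast
    have "q (s - t) \<le> C * norm (s - t)" using q' by blast
    also have "\<dots> \<le> C * B" using q' B[OF 0 t] by (intro mult_left_mono) auto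
    finally show ?case using t by auto
  next
    case (Suc k)
    obtain d s' where s': "d \<in> D" "s' \<in> T" "s = f (s' + d)"
    proof -
      have "s \<in> hutchinson f D T" using Suc.prems T(2) by blast
      then show ?thesis using that by (auto simp: hutchinson_def)
    qed
    obtain t' where t': "t' \<in> T'" "q (s' - t') \<le> c ^ k * (C * B)" using Suc.IH[OF s'(2)] by blast
    have "f (t' + d) \<in> T'" using T'(3) t'(1) s'(1) by (auto simp: hutchinson_def)
    moreover have "q (s - f (t' + d)) \<le> c ^ Suc k * (C * B)"
    proof -
      have "s - f (t' + d) = f (s' - t')" by (simp add: s'(3) linear_diff[OF f, symmetric])
      then have "q (s - f (t' + d)) \<le> c * q (s' - t')" using q' by simp
      also have "\<dots> \<le> c * (c ^ k * (C * B))" using t'(2) q' by (intro mult_left_mono) auto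
      finally show ?thesis by (simp add: mult.assoc)
    qed
    ultimately show ?case by blast
  qed
  have "x \<in> closure T'"
    unfolding closure_approachable
  proof (intro allI impI)
    fix e :: real assume "0 < e"
    then obtain k where k: "c ^ k * (C * B) < e"
      using geometric_eventually_less[of c e] q' by blast
    obtain t where t: "t \<in> T'" "q (x - t) \<le> c ^ k * (C * B)" using near[OF x] by blast
    have "norm (x - t) \<le> q (x - t)" using q' by blast
    with t k have "dist t x < e" by (simp add: dist_norm norm_minus_commute)
    with t show "\<exists>y\<in>T'. dist y x < e" by blast
  qed
  then show "x \<in> T'" by (simp add: closure_closed[OF compact_imp_closed[OF T'(2)]])
qed

section \<open>Covering space by translates of the attractor\<close>

text \<open>
  The right inverse \<open>g\<close> plays the part of the expanding map.  If \<open>t \<in> T\<close> and \<open>z = d + g z'\<close> then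
  \<open>f (t + z) = f (t + d) + z'\<close>, so \<open>f\<close> preserves \<open>X = T + Z\<close>.  A point of \<open>X\<close> at distance at most \<open>M\<close> from
  \<open>g\<^sup>k p\<close> is carried by \<open>f\<^sup>k\<close> to a point of \<open>X\<close> near \<open>p\<close>.  Thus \<open>X\<close> is dense, and it is closed.
\<close>

lemma translates_of_attractor_cover:
  fixes f g :: "'a::euclidean_space \<Rightarrow> 'a"
  assumes f: "linear f" and q: "adapted_norm f c C q" and inv: "\<And>x. f (g x) = x"
    and T: "T \<noteq> {}" "compact T" "T = hutchinson f D T"
    and Z: "closed Z" "\<And>z. z \<in> Z \<Longrightarrow> \<exists>d\<in>D. \<exists>z'\<in>Z. z = d + g z'"
    and dense: "\<And>p. \<exists>z\<in>Z. norm (p - z) \<le> M"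
  shows "(\<Union>t\<in>T. \<Union>z\<in>Z. {t + z}) = UNIV"
proof -
  note q' = q[unfolded adapted_norm_def]
  let ?X = "\<Union>t\<in>T. \<Union>z\<in>Z. {t + z}"
  have fX: "f x \<in> ?X" if x: "x \<in> ?X" for x
  proof -
    obtain t z where tz: "t \<in> T" "z \<in> Z" "x = t + z" using x by auto
    obtain d z' where d: "d \<in> D" "z' \<in> Z" "z = d + g z'" using Z(2)[OF tz(2)] by blast
    have "f x = f (t + d) + z'" by (simp add: tz d linear_add[OF f] inv)
    moreover have "f (t + d) \<in> T" using T(3) tz(1) d(1) by (auto simp: hutchinson_def)
    ultimately show ?thesis using d(2) by auto
  qed
  obtain t0 where t0: "t0 \<in> T" using T by blast
  have near: "\<exists>x\<in>?X. q (p - x) \<le> c ^ k * (C * M)" for p k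
  proof (induction k arbitrary: p)
    case 0
    obtain z where z: "z \<in> Z" "norm ((p - t0) - z) \<le> M" using dense by blast
    have "q (p - (t0 + z)) \<le> C * norm (p - (t0 + z))" using q' by blast
    also have "\<dots> \<le> C * M" using q' z(2) by (intro mult_left_mono) (auto simp: algebra_simps)
    finally show ?case using z(1) t0 by auto
  next
    case (Suc k)
    obtain x where x: "x \<in> ?X" "q (g p - x) \<le> c ^ k * (C * M)" using Suc.IH by blast
    have "p - f x = f (g p - x)" by (simp add: linear_diff[OF f] inv)
    then have "q (p - f x) \<le> c * q (g p - x)" using q' by simp
    also have "\<dots> \<le> c * (c ^ k * (C * M))" using x(2) q' by (intro mult_left_mono) auto
    finally have "q (p - f x) \<le> c ^ Suc k * (C * M)" by (simp add: mult.assoc)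
    with fX[OF x(1)] show ?case by blast
  qed
  have "p \<in> closure ?X" for p
    unfolding closure_approachable
  proof (intro allI impI)
    fix e :: real assume "0 < e"
    then obtain k where k: "c ^ k * (C * M) < e"
      using geometric_eventually_less[of c e] q' by blast
    obtain x where x: "x \<in> ?X" "q (p - x) \<le> c ^ k * (C * M)" using near by blast
    have "norm (p - x) \<le> q (p - x)" using q' by blast
    with x k have "dist x p < e" by (simp add: dist_norm norm_minus_commute)
    with x(1) show "\<exists>y\<in>?X. dist y p < e" by blast
  qed
  moreover have "closed ?X" by (rule compact_closed_sums[OF T(2) Z(1)])
  ultimately show ?thesis by (metis UNIV_eq_I closure_closed)
qed

text \<open>
  Otherwise the complements of the translates of \<open>T\<close> would be countably many dense open sets with empty
  intersection.
\<close>

lemma interior_nonempty_of_countable_cover: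
  fixes T :: "'a::euclidean_space set"
  assumes T: "closed T" and Z: "countable Z" and cover: "(\<Union>t\<in>T. \<Union>z\<in>Z. {t + z}) = UNIV"
  shows "interior T \<noteq> {}"
proof
  assume empty: "interior T = {}"
  let ?G = "(\<lambda>z. - ((+) z ` T)) ` Z"
  have "UNIV \<subseteq> closure (\<Inter>?G)"
  proof (rule Baire)
    fix U assume "U \<in> ?G"
    then obtain z where U: "U = - ((+) z ` T)" by blast
    have "interior ((+) z ` T) = {}" by (simp add: interior_translation empty)
    then show "openin (top_of_set UNIV) U \<and> UNIV \<subseteq> closure U"
      using closed_translation[OF T, of z] by (simp add: U closure_complement open_Compl)
  qed (use Z in auto)
  moreover have "\<Inter>?G = {}"
  proof -
    have "\<exists>z\<in>Z. x \<in> (+) z ` T" for x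
    proof -
      have "x \<in> (\<Union>t\<in>T. \<Union>z\<in>Z. {t + z})" using cover by simp
      then obtain t z where "t \<in> T" "z \<in> Z" "x = z + t" by (auto simp: add.commute)
      then show ?thesis by blast
    qed
    then show ?thesis by auto
  qed
  ultimately show False by simp
qed

section \<open>Integer vectors and digit sets\<close>

lemma of_int_vec_add: "of_int_vec (x + y) = of_int_vec x + of_int_vec y"
  by (simp add: of_int_vec_def vec_eq_iff)

lemma matrix_vector_mult_minus: "R *v (- u) = - (R *v u)" for R :: "'a::ring_1 ^ 'n ^ 'm"
  by (simp add: matrix_vector_mult_def vec_eq_iff sum_negf)

lemma of_int_vec_mult: "of_int_vec (R *v x) = map_matrix of_int R *v of_int_vec x"
  unfolding of_int_vec_def by (subst map_matrix_mult_vec) auto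

lemma closed_of_int_vec_image: "closed (of_int_vec ` Z)"
proof (rule discrete_imp_closed[of 1])
  have "x = y" if "dist (of_int_vec x) (of_int_vec y) < 1" for x y :: "int ^ 'n"
  proof -
    have "\<bar>x $ i - y $ i\<bar> < 1" for i
    proof -
      have "\<bar>real_of_int (x $ i) - real_of_int (y $ i)\<bar> < 1"
        using dist_vec_nth_le[of "of_int_vec x" i "of_int_vec y"] that
        by (simp add: of_int_vec_def dist_real_def)
      then show ?thesis by linarith
    qed
    then show ?thesis by (simp add: vec_eq_iff)
  qed
  then show "\<forall>x\<in>of_int_vec ` Z. \<forall>y\<in>of_int_vec ` Z. dist y x < 1 \<longrightarrow> y = x" by auto
qed simp

lemma near_of_int_vec:
  fixes p :: "real ^ 'n"
  shows "\<exists>u. norm (p - of_int_vec u) \<le> CARD('n)"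
proof -
  let ?u = "(\<chi> i. \<lfloor>p $ i\<rfloor>) :: int ^ 'n"
  have "norm (p - of_int_vec ?u) \<le> (\<Sum>i\<in>UNIV. \<bar>(p - of_int_vec ?u) $ i\<bar>)" by (rule norm_le_l1_cart)
  also have "\<dots> \<le> (\<Sum>i\<in>(UNIV::'n set). 1)"
    by (intro sum_mono) (simp add: of_int_vec_def, linarith)
  finally show ?thesis by auto
qed

lemma matrix_inv_expanding:
  fixes R :: "int ^ 'n ^ 'n"
  assumes "expanding R"
  shows "map_matrix real_of_int R ** matrix_inv (map_matrix of_int R) = mat 1"
    and "matrix_inv (map_matrix of_int R) ** map_matrix real_of_int R = mat 1"
  using someI_ex[OF expanding_imp_invertible[OF assms, unfolded invertible_def]]
  unfolding matrix_inv_def by auto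

lemma self_affine_set_is_attractor:
  fixes R :: "int ^ 'n ^ 'n"
  defines "f \<equiv> (*v) (matrix_inv (map_matrix real_of_int R))"
  assumes q: "adapted_norm f c C q" and D: "finite D" "D \<noteq> {}"
  defines "T \<equiv> self_affine_set R D"
  shows "T \<noteq> {}" and "compact T" and "T = hutchinson f (of_int_vec ` D) T"
proof -
  let ?D = "of_int_vec ` D"
  have f: "linear f" by (simp add: f_def)
  obtain S where S: "S \<noteq> {}" "compact S" "S = hutchinson f ?D S"
    using attractor_exists[OF f q, of ?D] D by auto
  have "self_affine_set R D = (THE S. S \<noteq> {} \<and> compact S \<and> S = hutchinson f ?D S)"
    by (simp add: self_affine_set_def hutchinson_def f_def)
  also have "\<dots> = S"
  proof (rule the_equality)
    show "S \<noteq> {} \<and> compact S \<and> S = hutchinson f ?D S" using S by blast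
    show "S' = S" if "S' \<noteq> {} \<and> compact S' \<and> S' = hutchinson f ?D S'" for S'
      using that attractor_subset[OF f q] S by (meson subset_antisym)
  qed
  finally have "T = S" by (simp add: T_def)
  then show "T \<noteq> {}" "compact T" "T = hutchinson f ?D T" using S by simp_all
qed

text \<open>
  The self-reproduction of \<open>Z = A + R \<int>\<^sup>n\<close> under the digits, where \<open>A = a ` {..<s}\<close>.  To expand
  \<open>a j + R w\<close>, write \<open>w = b + a i + R u\<close> with \<open>b \<in> B j\<close>, which is possible since \<open>A + B j\<close> represents
  the class of \<open>w\<close>; the digit is then \<open>a j + R b\<close> and the remainder \<open>a i + R u\<close>.
\<close>

lemma skew_product_expansion:
  fixes R :: "int ^ 'n ^ 'n"
  assumes D: "D = (\<Union>j<s. a j +o (*v) R ` B j)"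
    and res: "\<And>j. j < s \<Longrightarrow> complete_residue_set R (a ` {..<s} + B j)"
  defines "Z \<equiv> {a j + R *v w | j w. j < s}"
  assumes z: "z \<in> Z"
  shows "\<exists>d\<in>D. \<exists>z'\<in>Z. z = d + R *v z'"
proof -
  obtain j w where j: "j < s" "z = a j + R *v w" using z by (auto simp: Z_def)
  obtain b i u where b: "b \<in> B j" "i < s" "a i + b = w + R *v u"
    using res[OF j(1)] unfolding complete_residue_set_def elt_set_plus_def set_plus_def by blast
  have w: "w = b + (a i + R *v (- u))"
    using b(3) by (simp add: algebra_simps matrix_vector_mult_minus)
  have "a j + R *v b \<in> D" using j b D by (auto simp: elt_set_plus_def)
  moreover have "a i + R *v (- u) \<in> Z" using b by (auto simp: Z_def)
  moreover have "z = (a j + R *v b) + R *v (a i + R *v (- u))"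
    by (simp add: j(2) w matrix_vector_right_distrib add.assoc)
  ultimately show ?thesis by blast
qed

text \<open>Rounding \<open>R\<^sup>-\<^sup>1 (p - a)\<close> to an integer vector costs an error whose image under \<open>R\<close> is bounded.\<close>

lemma integer_coset_relatively_dense:
  fixes R :: "int ^ 'n ^ 'n" and a :: "int ^ 'n"
  assumes inv: "map_matrix real_of_int R ** P = mat 1"
  shows "\<exists>M. \<forall>p. \<exists>u. norm (p - of_int_vec (a + R *v u)) \<le> M"
proof -
  let ?g = "(*v) (map_matrix real_of_int R)"
  obtain K where K: "\<And>x. norm (?g x) \<le> K * norm x"
    using linear_bounded[of ?g] by auto
  have "\<exists>u. norm (p - of_int_vec (a + R *v u)) \<le> \<bar>K\<bar> * CARD('n)" for p
  proof -
    obtain u where u: "norm (P *v (p - of_int_vec a) - of_int_vec u) \<le> CARD('n)"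
      using near_of_int_vec by blast
    let ?y = "P *v (p - of_int_vec a) - of_int_vec u"
    have "p - of_int_vec (a + R *v u) = ?g ?y"
      by (simp add: of_int_vec_add of_int_vec_mult matrix_vector_mult_diff_distrib
         matrix_vector_mul_assoc inv)
    moreover have "norm (?g ?y) \<le> \<bar>K\<bar> * CARD('n)"
    proof -
      have "norm (?g ?y) \<le> \<bar>K\<bar> * norm ?y"
        using K[of ?y] by (rule order_trans) (simp add: mult_right_mono)
      also have "\<dots> \<le> \<bar>K\<bar> * CARD('n)" using u by (rule mult_left_mono) simp
      finally show ?thesis .
    qed
    ultimately show ?thesis by (intro exI[of _ u]) (simp only:)
  qed
  then show ?thesis by blast
qed

theorem theorem1p1:
  fixes R :: "int ^ 'n ^ 'n" and D :: "(int ^ 'n) set"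
  assumes "expanding R"
    and "finite D" and "int (card D) = \<bar>det R\<bar>"
    and "skew_product_form R D"
  shows "self_affine_tile R D"
proof -
  let ?A = "map_matrix real_of_int R"
  let ?P = "matrix_inv ?A"
  let ?f = "(*v) ?P" and ?g = "(*v) ?A"
  let ?T = "self_affine_set R D"
  note inverse = matrix_inv_expanding[OF assms(1)]
  have f: "linear ?f" by simp
  have inv: "?f (?g x) = x" for x by (simp add: matrix_vector_mul_assoc inverse)
  obtain c C q where q: "adapted_norm ?f c C q"
    using exists_adapted_norm[OF f] expanding_inverse_iterates_tendsto_0[OF assms(1) inverse(1)]
    by blast
  obtain s :: nat and a B where D: "D = (\<Union>j<s. a j +o (*v) R ` B j)"
    and res: "\<And>j. j < s \<Longrightarrow> complete_residue_set R (a ` {..<s} + B j)"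
    using assms(4) by (auto simp: skew_product_form_def skew_product_form_stage_def)
  \<comment> \<open>Expansion excludes the degenerate case \<open>s = 0\<close>, in which there is no attractor to speak of.\<close>
  have "det R \<noteq> 0"
  proof
    assume "det R = 0"
    have "of_int (det R) = det ?A" unfolding det_def by simp
    then show False using \<open>det R = 0\<close> expanding_imp_invertible[OF assms(1)]
      by (simp add: invertible_det_nz)
  qed
  then have "D \<noteq> {}" using assms(3) by auto
  then obtain j0 where j0: "j0 < s" using D by auto
  note T = self_affine_set_is_attractor[OF q assms(2) \<open>D \<noteq> {}\<close>]
  define Z where "Z = {a j + R *v w | j w. j < s}"
  let ?Z = "of_int_vec ` Z"
  have Z_step: "\<exists>d\<in>of_int_vec ` D. \<exists>z'\<in>?Z. z = d + ?g z'" if "z \<in> ?Z" for z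
  proof -
    obtain y where y: "y \<in> Z" "z = of_int_vec y" using \<open>z \<in> ?Z\<close> by blast
    obtain d y' where "d \<in> D" "y' \<in> Z" "y = d + R *v y'"
      using skew_product_expansion[OF D res] y(1) unfolding Z_def by blast
    then show ?thesis using y(2) by (auto simp: of_int_vec_add of_int_vec_mult)
  qed
  obtain M where M: "\<And>p. \<exists>u. norm (p - of_int_vec (a j0 + R *v u)) \<le> M"
    using integer_coset_relatively_dense[OF inverse(1)] by blast
  have Z_dense: "\<exists>z\<in>?Z. norm (p - z) \<le> M" for p
  proof -
    obtain u where "norm (p - of_int_vec (a j0 + R *v u)) \<le> M" using M by blast
    moreover have "a j0 + R *v u \<in> Z" using j0 by (auto simp: Z_def)
    ultimately show ?thesis by blast
  qed
  have "(\<Union>t\<in>?T. \<Union>z\<in>?Z. {t + z}) = UNIV"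
    by (rule translates_of_attractor_cover[OF f q inv T closed_of_int_vec_image Z_step Z_dense])
  moreover have "countable ?Z" by simp
  ultimately have "interior ?T \<noteq> {}"
    using interior_nonempty_of_countable_cover T(2) compact_imp_closed by blast
  then show ?thesis by (simp add: self_affine_tile_def)
qed

end
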